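(* Let $S = \langle n_1, \ldots, n_k\rangle$ be a numerical semigroup with minimal generating set $n_1,\ldots,n_k$, and let $n \in S$. The number of edges in the factorization support graph $\nabla_S(n)$ is given by $$|E(\nabla_S(n))| = \binom{|\mathsf{Z}_S(n)|}{2} + \sum_{\{I,J\}} (-1)^{k-|I|-|J|+1}\, |\mathsf{Z}_I(n)|\,|\mathsf{Z}_J(n)|,$$ where the sum ranges over all unordered pairs $\{I,J\}$ of nonempty, proper, disjoint subsets $I, J \subseteq [k]$. In particular, $|E(\nabla_S(n))|$ is a quasipolynomial function of $n$ of degree $2k-2$ with leading coefficient (the coefficient of $n^{2k-2}$ for $n$ divisible by $c$) $$\frac{c^2}{2\left((k-1)!\right)^2 n_1^2\cdots n_k^2}$$ and period dividing $\operatorname{lcm}(n_1,\ldots,n_k)$, where $c = \gcd(n_1,\ldots,n_k)$.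
   Context: Write $[k]=\{1,\ldots,k\}$. For positive integers $n_1,\ldots,n_k$, the numerical semigroup they generate is $S=\langle n_1,\ldots,n_k\rangle=\{z_1n_1+\cdots+z_kn_k : z_i\in\mathbb{Z}_{\ge 0}\}$; the generators are not required to be relatively prime. The generating set is minimal if no proper subset of it generates the same set $S$. The set of factorizations of $n$ is $\mathsf{Z}_S(n)=\{(z_1,\ldots,z_k)\in\mathbb{Z}_{\ge 0}^k : n = z_1n_1+\cdots+z_kn_k\}$ (empty if $n\notin S$). For $\mathbf{z}\in \mathsf{Z}_S(n)$, $\operatorname{supp}(\mathbf{z})=\{i : z_i>0\}$. For $I\subseteq[k]$, $\mathsf{Z}_I(n)$ denotes $\mathsf{Z}_T(n)$ where $T=\langle n_i : i\in I\rangle$ (factorizations of $n$ using only the generators $n_i$ with $i\in I$). The factorization support graph $\nabla_S(n)$ is the simple graph with vertex set $\mathsf{Z}_S(n)$ and an edge between $\mathbf{z}$ and $\mathbf{z}'$ whenever $\operatorname{supp}(\mathbf{z})\cap\operatorname{supp}(\mathbf{z}')\neq\emptyset$; $E(\cdot)$ denotes the edge set. A function $f:\mathbb{Z}_{\ge 0}\to\mathbb{R}$ is a quasipolynomial of degree $d$ if there are periodic functions $a_0,\ldots,a_d:\mathbb{Z}_{\ge 0}\to\mathbb{R}$, with $a_d$ not identically $0$, such that $f(n)=a_d(n)n^d+\cdots+a_1(n)n+a_0(n)$; its period is the minimal positive integer $p$ with $a_i(n+p)=a_i(n)$ for all $0\le i\le d$.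
   Formalization: The formula and the agreement with the quasipolynomial are claimed except at n = 0 with k even (there are 0 edges there but the formula gives −1), and the "in particular" part is claimed only for k ≥ 2 (for k = 1 there are never edges, so the leading coefficient 1/2 fails). *)

theory Defs
  imports Complex_Main
begin

text \<open>
  The generators \<open>n\<^sub>1, \<dots>, n\<^sub>k\<close> are the values \<open>g 1, \<dots>, g k\<close> of a function \<open>g\<close>; values of \<open>g\<close>
  outside \<open>{1..k}\<close> are never used. A subfamily of the generators is given by its index set.
\<close>

definition gen_semigroup :: "(nat \<Rightarrow> nat) \<Rightarrow> nat set \<Rightarrow> nat set" where
  "gen_semigroup g I = {\<Sum>i\<in>I. z i * g i | z :: nat \<Rightarrow> nat. True}"

text \<open>Minimality is stated for the indexed family, so it also rules out repeated generators.\<close>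

definition minimal_generators :: "(nat \<Rightarrow> nat) \<Rightarrow> nat set \<Rightarrow> bool" where
  "minimal_generators g K \<longleftrightarrow> (\<forall>I. I \<subset> K \<longrightarrow> gen_semigroup g I \<noteq> gen_semigroup g K)"

text \<open>
  A tuple indexed by \<open>I\<close> is represented by its extension by \<open>0\<close> to all of \<open>nat\<close>, so that
  distinct factorizations are distinct functions.
\<close>

definition factorizations :: "(nat \<Rightarrow> nat) \<Rightarrow> nat set \<Rightarrow> nat \<Rightarrow> (nat \<Rightarrow> nat) set" where
  "factorizations g I n = {z. (\<forall>i. i \<notin> I \<longrightarrow> z i = 0) \<and> n = (\<Sum>i\<in>I. z i * g i)}"

definition supp :: "(nat \<Rightarrow> nat) \<Rightarrow> nat set" where
  "supp z = {i. z i > 0}"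

text \<open>A simple graph is a pair of a vertex set and a set of two-element edges.\<close>

type_synonym 'a sgraph = "'a set \<times> 'a set set"

definition edges :: "'a sgraph \<Rightarrow> 'a set set" where
  "edges G = snd G"

definition support_graph :: "(nat \<Rightarrow> nat) \<Rightarrow> nat set \<Rightarrow> nat \<Rightarrow> (nat \<Rightarrow> nat) sgraph" where
  "support_graph g K n =
     (factorizations g K n,
      {{z, z'} | z z'. z \<in> factorizations g K n \<and> z' \<in> factorizations g K n \<and>
                       z \<noteq> z' \<and> supp z \<inter> supp z' \<noteq> {}})"

text \<open>
  Unordered pairs are two-element sets: disjoint nonempty \<open>I\<close> and \<open>J\<close> are distinct.
  Inclusion-exclusion over these pairs counts the non-edges only if every factorization has
  nonempty support. For \<open>n = 0\<close> this fails, and the count is then off by one exactly when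
  the number of generators is even.
\<close>

definition disjoint_pairs :: "nat set \<Rightarrow> nat set set set" where
  "disjoint_pairs K =
     {{I, J} | I J. I \<subset> K \<and> J \<subset> K \<and> I \<noteq> {} \<and> J \<noteq> {} \<and> I \<inter> J = {}}"

definition periodic :: "(nat \<Rightarrow> real) \<Rightarrow> bool" where
  "periodic a \<longleftrightarrow> (\<exists>p>0. \<forall>n. a (n + p) = a n)"

text \<open>
  The coefficient functions \<open>a 0, \<dots>, a d\<close> are uniquely determined by \<open>f\<close>, so it is harmless
  that leading coefficient and period are read off from a given choice of \<open>a\<close>.
\<close>

definition quasipolynomial_with_coeffs ::
    "(nat \<Rightarrow> real) \<Rightarrow> nat \<Rightarrow> (nat \<Rightarrow> nat \<Rightarrow> real) \<Rightarrow> bool" where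
  "quasipolynomial_with_coeffs f d a \<longleftrightarrow>
     (\<forall>i\<le>d. periodic (a i)) \<and> (\<exists>n. a d n \<noteq> 0) \<and>
     (\<forall>n. f n = (\<Sum>i\<le>d. a i n * real n ^ i))"

definition quasi_period :: "nat \<Rightarrow> (nat \<Rightarrow> nat \<Rightarrow> real) \<Rightarrow> nat" where
  "quasi_period d a = (LEAST p. p > 0 \<and> (\<forall>i\<le>d. \<forall>n. a i (n + p) = a i n))"

end

theory Submission
  imports Defs "HOL-Number_Theory.Cong" "HOL-Computational_Algebra.Polynomial"
begin

text \<open>
  Edges: for subsets \<open>A, B\<close> of a finite \<open>K\<close>, the sum of \<open>(-1) ^ (|K| - |I| - |J|)\<close> over all disjoint
  \<open>I \<supseteq> A\<close>, \<open>J \<supseteq> B\<close> inside \<open>K\<close> is \<open>1\<close> if \<open>A\<close> and \<open>B\<close> are disjoint and \<open>0\<close> otherwise. Summed over the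
  supports of all pairs of factorizations, this counts the non-edges.

  Quasipolynomiality: let \<open>L\<close> be a common multiple of the generators. Using the generator \<open>g j\<close> one
  more time repeatedly shows that the number of factorizations over \<open>I \<union> {j}\<close> changes from \<open>n\<close> to
  \<open>n + L\<close> by the sum, over \<open>0 < q \<le> L / g j\<close>, of the numbers of factorizations of \<open>n + q * g j\<close> over
  \<open>I\<close>. By induction on \<open>I\<close> this difference is a quasipolynomial, and a discrete antiderivative on
  each residue class modulo \<open>L\<close> raises the degree by one. No argument below \<open>n\<close> occurs, so the
  result is exact for all \<open>n \<ge> 0\<close>.
\<close>

subsection \<open>Counting the edges\<close>

lemma alternating_sum_Pow:
  assumes "finite S"
  shows "(\<Sum>T\<in>Pow S. (- 1) ^ card T :: int) = (if S = {} then 1 else 0)"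
  using assms
proof (induction rule: finite_induct)
  case (insert x S)
  have *: "(\<Sum>T\<in>insert x ` Pow S. (- 1) ^ card T :: int) = (\<Sum>T\<in>Pow S. (- 1) ^ card (insert x T))"
    using insert by (intro sum.reindex[unfolded o_def]) (auto simp: inj_on_def)
  have **: "(\<Sum>T\<in>Pow S. (- 1) ^ card (insert x T) :: int) = (\<Sum>T\<in>Pow S. - ((- 1) ^ card T))"
    using insert by (intro sum.cong refl) (subst card_insert_disjoint; auto dest: rev_finite_subset)
  show ?case
    using insert unfolding Pow_insert
    by (subst sum.union_disjoint) (auto simp: * ** sum_negf)
qed simp

text \<open>Complementation in \<open>M\<close> turns the interval from \<open>B\<close> to
  \<open>M\<close> into the power set of \<open>M - B\<close>, whose alternating sum vanishes unless
  \<open>M - B\<close> is empty.\<close>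

lemma alternating_sum_interval:
  assumes "finite M" "B \<subseteq> M"
  shows "(\<Sum>J | B \<subseteq> J \<and> J \<subseteq> M. (- 1) ^ card (M - J) :: int) = (if B = M then 1 else 0)"
proof -
  have "(\<Sum>J | B \<subseteq> J \<and> J \<subseteq> M. (- 1) ^ card (M - J) :: int) = (\<Sum>T\<in>Pow (M - B). (- 1) ^ card T)"
    by (rule sum.reindex_bij_witness[where i = "\<lambda>T. M - T" and j = "\<lambda>J. M - J"])
      (use assms in \<open>auto simp: double_diff\<close>)
  also have "\<dots> = (if B = M then 1 else 0)"
    using assms by (subst alternating_sum_Pow) auto
  finally show ?thesis .
qed

text \<open>For fixed \<open>I\<close>, the sets \<open>J\<close> form the interval from
  \<open>B\<close> to \<open>K - I\<close>, so the inner sum is \<open>1\<close> for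
  \<open>I = K - B\<close> and \<open>0\<close> otherwise. This \<open>I\<close> is in range exactly
  when \<open>A\<close> lies in \<open>K - B\<close>. Since \<open>I\<close> and \<open>J\<close>
  are disjoint subsets of \<open>K\<close>, the truncated subtraction in the exponent loses
  nothing.\<close>

lemma alternating_sum_disjoint_pairs:
  assumes "finite K" "A \<subseteq> K" "B \<subseteq> K"
  shows "(\<Sum>(I, J) | I \<subseteq> K \<and> J \<subseteq> K \<and> I \<inter> J = {} \<and> A \<subseteq> I \<and> B \<subseteq> J.
           (- 1) ^ (card K - card I - card J) :: int) = (if A \<inter> B = {} then 1 else 0)"
proof -
  have "{(I, J). I \<subseteq> K \<and> J \<subseteq> K \<and> I \<inter> J = {} \<and> A \<subseteq> I \<and> B \<subseteq> J} =
        (SIGMA I:{I. A \<subseteq> I \<and> I \<subseteq> K - B}. {J. B \<subseteq> J \<and> J \<subseteq> K - I})"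
    using assms by auto
  then have "(\<Sum>(I, J) | I \<subseteq> K \<and> J \<subseteq> K \<and> I \<inter> J = {} \<and> A \<subseteq> I \<and> B \<subseteq> J.
           (- 1) ^ (card K - card I - card J) :: int) =
        (\<Sum>I | A \<subseteq> I \<and> I \<subseteq> K - B. \<Sum>J | B \<subseteq> J \<and> J \<subseteq> K - I. (- 1) ^ (card K - card I - card J))"
    using assms by (subst sum.Sigma) (auto intro: finite_subset[of _ "Pow K"])
  also have "\<dots> = (\<Sum>I | A \<subseteq> I \<and> I \<subseteq> K - B. \<Sum>J | B \<subseteq> J \<and> J \<subseteq> K - I. (- 1) ^ card ((K - I) - J))"
  proof (intro sum.cong refl arg_cong[where f = "(^) (- 1)"], clarify)
    fix I J assume "I \<subseteq> K - B" "J \<subseteq> K - I"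
    then have "I \<subseteq> K" "J \<subseteq> K - I" by auto
    moreover from this have "finite I" "finite J"
      using assms(1) by (meson Diff_subset finite_subset order_trans)+
    ultimately show "card K - card I - card J = card (K - I - J)"
      using card_Diff_subset[of I K] card_Diff_subset[of J "K - I"] by auto
  qed
  also have "\<dots> = (\<Sum>I | A \<subseteq> I \<and> I \<subseteq> K - B. if B = K - I then 1 else 0)"
    using assms by (intro sum.cong refl alternating_sum_interval) auto
  also have "\<dots> = (\<Sum>I | A \<subseteq> I \<and> I \<subseteq> K - B. if I = K - B then 1 else 0)"
    using assms by (intro sum.cong refl) auto
  also have "\<dots> = (if A \<inter> B = {} then 1 else 0)"
    using assms by (subst sum.delta) (auto intro: finite_subset[of _ "Pow K"])
  finally show ?thesis .
qed

text \<open>By symmetry and irreflexivity of \<open>R\<close>, each unordered pair is the image of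
  exactly two ordered pairs.\<close>

lemma sum_unordered_pairs:
  fixes h :: "'a set \<Rightarrow> int"
  assumes "finite R" "\<And>x y. (x, y) \<in> R \<Longrightarrow> (y, x) \<in> R" "\<And>x y. (x, y) \<in> R \<Longrightarrow> x \<noteq> y"
  shows "(\<Sum>(x, y)\<in>R. h {x, y}) = 2 * (\<Sum>P\<in>{{x, y} | x y. (x, y) \<in> R}. h P)"
proof -
  let ?g = "\<lambda>(x, y). {x, y}"
  have img: "{{x, y} | x y. (x, y) \<in> R} = ?g ` R" by (auto simp: image_def)
  have "(\<Sum>(x, y)\<in>R. h {x, y}) = (\<Sum>p\<in>R. h (?g p))"
    by (simp add: case_prod_unfold)
  also have "\<dots> = (\<Sum>P\<in>?g ` R. \<Sum>p\<in>{p \<in> R. ?g p = P}. h (?g p))"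
    by (rule sum.image_gen) fact
  also have "\<dots> = (\<Sum>P\<in>?g ` R. 2 * h P)"
  proof (rule sum.cong[OF refl])
    fix P assume "P \<in> ?g ` R"
    then obtain x y where xy: "(x, y) \<in> R" "P = {x, y}" by auto
    then have "{p \<in> R. ?g p = P} = {(x, y), (y, x)}"
      using assms(2) by (auto simp: doubleton_eq_iff)
    moreover have "x \<noteq> y" using xy assms(3) by blast
    ultimately show "(\<Sum>p\<in>{p \<in> R. ?g p = P}. h (?g p)) = 2 * h P"
      using xy by (simp add: insert_commute)
  qed
  finally show ?thesis unfolding img by (simp add: sum_distrib_left)
qed

section \<open>Factorizations and their supports\<close>

lemma finite_factorizations:
  assumes "finite I" "\<forall>i\<in>I. g i > 0"
  shows "finite (factorizations g I n)"
proof (rule finite_subset)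
  show "factorizations g I n \<subseteq> {z. \<forall>i. (i \<in> I \<longrightarrow> z i \<in> {..n}) \<and> (i \<notin> I \<longrightarrow> z i = 0)}"
  proof (clarsimp simp: factorizations_def)
    fix z i assume i: "i \<in> I"
    have "z i \<le> z i * g i" using assms i by (simp add: Suc_le_eq)
    also have "\<dots> \<le> (\<Sum>i\<in>I. z i * g i)" using assms i by (intro member_le_sum) auto
    finally show "z i \<le> (\<Sum>i\<in>I. z i * g i)" .
  qed
  show "finite {z. \<forall>i. (i \<in> I \<longrightarrow> z i \<in> {..n}) \<and> (i \<notin> I \<longrightarrow> z i = (0::nat))}"
    using assms by (intro finite_set_of_finite_funs) auto
qed

text \<open>Extension by \<open>0\<close> makes a factorization over \<open>I\<close> literally a
  factorization over \<open>K\<close>. All counts thus become sums of indicators over the single set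
  \<open>factorizations g K n\<close>.\<close>

lemma factorizations_subset:
  assumes "finite K" "I \<subseteq> K"
  shows "factorizations g I n = {z \<in> factorizations g K n. supp z \<subseteq> I}"
proof -
  have "(\<Sum>i\<in>I. z i * g i) = (\<Sum>i\<in>K. z i * g i)" if "\<forall>i. i \<notin> I \<longrightarrow> z i = 0" for z
    using that assms by (intro sum.mono_neutral_left) auto
  moreover have "(\<forall>i. i \<notin> I \<longrightarrow> z i = 0) \<longleftrightarrow> supp z \<subseteq> I" for z
    by (auto simp: supp_def)
  moreover have "supp z \<subseteq> I \<Longrightarrow> \<forall>i. i \<notin> K \<longrightarrow> z i = 0" for z
    using assms(2) by (auto simp: supp_def)
  ultimately show ?thesis by (simp add: factorizations_def set_eq_iff) metis
qed

lemma supp_factorization_subset: "z \<in> factorizations g K n \<Longrightarrow> supp z \<subseteq> K"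
  by (auto simp: factorizations_def supp_def)

lemma supp_factorization_nonempty:
  "\<lbrakk>z \<in> factorizations g K n; n \<noteq> 0\<rbrakk> \<Longrightarrow> supp z \<noteq> {}"
proof
  assume z: "z \<in> factorizations g K n" "n \<noteq> 0" "supp z = {}"
  then have "z i = 0" for i by (auto simp: supp_def)
  with z(1,2) show False by (simp add: factorizations_def)
qed

lemma factorizations_zero:
  assumes "finite K" "\<forall>i\<in>K. g i > 0"
  shows "factorizations g K 0 = {\<lambda>_. 0}"
proof (intro equalityI subsetI)
  fix z assume z: "z \<in> factorizations g K 0"
  have "z i = 0" for i
  proof (cases "i \<in> K")
    case True
    then have "z i * g i = 0" using z assms by (simp add: factorizations_def)
    then show ?thesis using True assms(2) by auto
  qed (use z in \<open>auto simp: factorizations_def\<close>)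
  then show "z \<in> {\<lambda>_. 0}" by auto
qed (auto simp: factorizations_def)

text \<open>Writing both counts as indicator sums and swapping the summations leaves, for each pair
  \<open>z\<close>, \<open>z'\<close>, the signed sum of
  \<open>alternating_sum_disjoint_pairs\<close> with \<open>A = supp z\<close> and
  \<open>B = supp z'\<close>. Empty and improper \<open>I\<close>, \<open>J\<close> are still
  included here, so the identity also holds for \<open>n = 0\<close>.\<close>

lemma sum_disjoint_supports:
  assumes "finite K" "\<forall>i\<in>K. g i > 0"
  shows "(\<Sum>(I, J) | I \<subseteq> K \<and> J \<subseteq> K \<and> I \<inter> J = {}.
            (- 1) ^ (card K - card I - card J) *
            (int (card (factorizations g I n)) * int (card (factorizations g J n)))) =
         int (card {(z, z'). z \<in> factorizations g K n \<and> z' \<in> factorizations g K n \<and>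
           supp z \<inter> supp z' = {}})"
proof -
  let ?Z = "factorizations g K n"
  let ?s = "\<lambda>I J. (- 1) ^ (card K - card I - card J) :: int"
  let ?AP = "{(I, J). I \<subseteq> K \<and> J \<subseteq> K \<and> I \<inter> J = {}}"
  have fin: "finite ?Z" by (rule finite_factorizations[OF assms])
  have finAP: "finite ?AP"
    by (rule finite_subset[of _ "Pow K \<times> Pow K"]) (use assms in auto)
  have card: "int (card (factorizations g I n)) = (\<Sum>z\<in>?Z. if supp z \<subseteq> I then 1 else 0)"
    if "I \<subseteq> K" for I
    using fin by (simp add: factorizations_subset[OF assms(1) that] sum.If_cases Int_def)
  have "(\<Sum>(I, J)\<in>?AP. ?s I J *
            (int (card (factorizations g I n)) * int (card (factorizations g J n)))) =
        (\<Sum>(I, J)\<in>?AP. \<Sum>(z, z')\<in>?Z \<times> ?Z. if supp z \<subseteq> I \<and> supp z' \<subseteq> J then ?s I J else 0)"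
  proof (intro sum.cong refl, clarify)
    fix I J assume "I \<subseteq> K" "J \<subseteq> K"
    then have "?s I J * (int (card (factorizations g I n)) * int (card (factorizations g J n))) =
      ?s I J * (\<Sum>(z, z')\<in>?Z \<times> ?Z. (if supp z \<subseteq> I then 1 else 0) * (if supp z' \<subseteq> J then 1 else 0))"
      by (simp only: card sum_product sum.cartesian_product)
    also have "\<dots> = (\<Sum>(z, z')\<in>?Z \<times> ?Z. if supp z \<subseteq> I \<and> supp z' \<subseteq> J then ?s I J else 0)"
      unfolding sum_distrib_left by (intro sum.cong) auto
    finally show "?s I J * (int (card (factorizations g I n)) * int (card (factorizations g J n))) =
      (\<Sum>(z, z')\<in>?Z \<times> ?Z. if supp z \<subseteq> I \<and> supp z' \<subseteq> J then ?s I J else 0)" .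
  qed
  also have "\<dots> = (\<Sum>(z, z')\<in>?Z \<times> ?Z. \<Sum>(I, J)\<in>?AP. if supp z \<subseteq> I \<and> supp z' \<subseteq> J then ?s I J else 0)"
    unfolding case_prod_unfold by (rule sum.swap)
  also have "\<dots> = (\<Sum>(z, z')\<in>?Z \<times> ?Z. if supp z \<inter> supp z' = {} then 1 else 0)"
  proof (intro sum.cong refl, clarify)
    fix z z' assume z: "z \<in> ?Z" "z' \<in> ?Z"
    have "(\<Sum>(I, J)\<in>?AP. if supp z \<subseteq> I \<and> supp z' \<subseteq> J then ?s I J else 0) =
      (\<Sum>p\<in>?AP. if supp z \<subseteq> fst p \<and> supp z' \<subseteq> snd p then ?s (fst p) (snd p) else 0)"
      by (simp add: case_prod_unfold)
    also have "\<dots> = (\<Sum>p | p \<in> ?AP \<and> supp z \<subseteq> fst p \<and> supp z' \<subseteq> snd p. ?s (fst p) (snd p))"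
      by (rule sum.inter_filter[OF finAP, symmetric])
    also have "\<dots> = (\<Sum>(I, J) | I \<subseteq> K \<and> J \<subseteq> K \<and> I \<inter> J = {} \<and> supp z \<subseteq> I \<and> supp z' \<subseteq> J. ?s I J)"
      by (intro sum.cong) auto
    also have "\<dots> = (if supp z \<inter> supp z' = {} then 1 else 0)"
      using z by (intro alternating_sum_disjoint_pairs assms supp_factorization_subset)
    finally show "(\<Sum>(I, J)\<in>?AP. if supp z \<subseteq> I \<and> supp z' \<subseteq> J then ?s I J else 0) =
      (if supp z \<inter> supp z' = {} then 1 else 0)" .
  qed
  also have "\<dots> = int (card {p \<in> ?Z \<times> ?Z. supp (fst p) \<inter> supp (snd p) = {}})"
    using fin by (simp add: case_prod_unfold sum.If_cases Int_def)
  also have "{p \<in> ?Z \<times> ?Z. supp (fst p) \<inter> supp (snd p) = {}} =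
    {(z, z'). z \<in> ?Z \<and> z' \<in> ?Z \<and> supp z \<inter> supp z' = {}}" by auto
  finally show ?thesis .
qed

section \<open>From ordered pairs of factorizations to edges\<close>

lemma card_unordered_pairs:
  assumes "finite R" "\<And>x y. (x, y) \<in> R \<Longrightarrow> (y, x) \<in> R" "\<And>x y. (x, y) \<in> R \<Longrightarrow> x \<noteq> y"
  shows "card R = 2 * card {{x, y} | x y. (x, y) \<in> R}"
  using sum_unordered_pairs[OF assms, of "\<lambda>_. 1"] by (simp add: case_prod_unfold)

text \<open>Ordered pairs of distinct factorizations split into those with meeting and those with
  disjoint supports. For \<open>n \<noteq> 0\<close> disjoint supports already force
  \<open>z \<noteq> z'\<close>, because a nonempty support meets itself.\<close>

lemma edges_plus_disjoint_supports:
  assumes "finite K" "\<forall>i\<in>K. g i > 0" "n \<noteq> 0"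
  shows "2 * card (edges (support_graph g K n)) +
      card {(z, z'). z \<in> factorizations g K n \<and> z' \<in> factorizations g K n \<and> supp z \<inter> supp z' = {}} =
    2 * (card (factorizations g K n) choose 2)"
proof -
  let ?Z = "factorizations g K n"
  let ?A = "{(z, z'). z \<in> ?Z \<and> z' \<in> ?Z \<and> z \<noteq> z'}"
  let ?E = "{(z, z'). z \<in> ?Z \<and> z' \<in> ?Z \<and> z \<noteq> z' \<and> supp z \<inter> supp z' \<noteq> {}}"
  let ?D = "{(z, z'). z \<in> ?Z \<and> z' \<in> ?Z \<and> supp z \<inter> supp z' = {}}"
  have finZ: "finite ?Z" by (rule finite_factorizations[OF assms(1,2)])
  have fin: "finite R" if "R \<subseteq> ?Z \<times> ?Z" for R
    using that finZ by (meson finite_SigmaI finite_subset)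
  have finE: "finite ?E" "finite ?D" "finite ?A" by (rule fin, blast)+
  have "?A = ?E \<union> ?D"
    using supp_factorization_nonempty[OF _ assms(3), of _ g K] by auto
  moreover have "?E \<inter> ?D = {}" by auto
  ultimately have "card ?A = card ?E + card ?D"
    using finE by (simp add: card_Un_disjoint)
  moreover have "card ?A = 2 * (card ?Z choose 2)"
  proof -
    have "{{x, y} | x y. (x, y) \<in> ?A} = {B. B \<subseteq> ?Z \<and> card B = 2}"
      by (auto simp: card_2_iff)
    moreover have "card ?A = 2 * card {{x, y} | x y. (x, y) \<in> ?A}"
      by (rule card_unordered_pairs[OF finE(3)]) auto
    ultimately show ?thesis using n_subsets[OF finZ, of 2] by (simp only:)
  qed
  moreover have "card ?E = 2 * card (edges (support_graph g K n))"
  proof -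
    have "edges (support_graph g K n) = {{x, y} | x y. (x, y) \<in> ?E}"
      by (simp add: edges_def support_graph_def)
    moreover have "card ?E = 2 * card {{x, y} | x y. (x, y) \<in> ?E}"
      by (rule card_unordered_pairs[OF finE(1)]) auto
    ultimately show ?thesis by (simp only:)
  qed
  ultimately show ?thesis by simp
qed

text \<open>Every pair dropped from the full sum has an empty member, since \<open>I = K\<close>
  forces \<open>J = {}\<close> and conversely. Such a term vanishes because
  \<open>n \<noteq> 0\<close> has no factorization over the empty set.\<close>

lemma sum_ordered_pairs_disjoint:
  assumes "finite K" "\<forall>i\<in>K. g i > 0" "n \<noteq> 0"
  shows "(\<Sum>(I, J) | I \<subset> K \<and> J \<subset> K \<and> I \<noteq> {} \<and> J \<noteq> {} \<and> I \<inter> J = {}.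
            (- 1) ^ (card K - card I - card J) *
            (int (card (factorizations g I n)) * int (card (factorizations g J n)))) =
         int (card {(z, z'). z \<in> factorizations g K n \<and> z' \<in> factorizations g K n \<and>
           supp z \<inter> supp z' = {}})"
proof -
  have 0: "factorizations g {} n = {}" using assms by (auto simp: factorizations_def)
  have "finite {(I, J). I \<subseteq> K \<and> J \<subseteq> K \<and> I \<inter> J = {}}"
    by (rule finite_subset[of _ "Pow K \<times> Pow K"]) (use assms in auto)
  then show ?thesis
    unfolding sum_disjoint_supports[OF assms(1,2), symmetric]
  proof (rule sum.mono_neutral_left)
    show "\<forall>p\<in>{(I, J). I \<subseteq> K \<and> J \<subseteq> K \<and> I \<inter> J = {}} -
        {(I, J). I \<subset> K \<and> J \<subset> K \<and> I \<noteq> {} \<and> J \<noteq> {} \<and> I \<inter> J = {}}.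
      (case p of (I, J) \<Rightarrow> (- 1) ^ (card K - card I - card J) *
        (int (card (factorizations g I n)) * int (card (factorizations g J n)))) = 0"
    proof
      fix p assume "p \<in> {(I, J). I \<subseteq> K \<and> J \<subseteq> K \<and> I \<inter> J = {}} -
        {(I, J). I \<subset> K \<and> J \<subset> K \<and> I \<noteq> {} \<and> J \<noteq> {} \<and> I \<inter> J = {}}"
      then have "fst p = {} \<or> snd p = {}" by fastforce
      then show "(case p of (I, J) \<Rightarrow> (- 1) ^ (card K - card I - card J) *
        (int (card (factorizations g I n)) * int (card (factorizations g J n)))) = 0"
        by (auto simp: 0 case_prod_unfold)
    qed
  qed auto
qed

text \<open>This settles \<open>n = 0\<close>, where every count is \<open>1\<close> and only the
  signs remain. The signed sum over all disjoint pairs is \<open>1\<close>, and for odd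
  \<open>card K\<close> the pairs with an empty member already account for it.\<close>

lemma alternating_sum_proper_pairs:
  fixes K :: "'a set"
  assumes "finite K" "odd (card K)"
  shows "(\<Sum>(I, J) | I \<subset> K \<and> J \<subset> K \<and> I \<noteq> {} \<and> J \<noteq> {} \<and> I \<inter> J = {}.
            (- 1) ^ (card K - card I - card J) :: int) = 0"
proof -
  let ?s = "\<lambda>(I, J). (- 1) ^ (card K - card I - card J) :: int"
  let ?OP = "{(I, J). I \<subset> K \<and> J \<subset> K \<and> I \<noteq> {} \<and> J \<noteq> {} \<and> I \<inter> J = {}}"
  let ?L = "{{} :: 'a set} \<times> Pow K" and ?R = "(Pow K - {{}}) \<times> {{} :: 'a set}"
  have "K \<noteq> {}" using assms by auto
  have fin: "finite ?OP"
    by (rule finite_subset[of _ "Pow K \<times> Pow K"]) (use assms in auto)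
  have alt: "(\<Sum>J\<in>Pow K. (- 1) ^ (card K - card J) :: int) = 0"
  proof -
    have "(\<Sum>J\<in>Pow K. (- 1) ^ (card K - card J) :: int) = (\<Sum>J | {} \<subseteq> J \<and> J \<subseteq> K. (- 1) ^ card (K - J))"
      using assms by (intro sum.cong) (auto simp: card_Diff_subset finite_subset)
    then show ?thesis using alternating_sum_interval[of K "{}"] assms \<open>K \<noteq> {}\<close> by auto
  qed
  have split: "{(I, J). I \<subseteq> K \<and> J \<subseteq> K \<and> I \<inter> J = {} \<and> {} \<subseteq> I \<and> {} \<subseteq> J} = ?OP \<union> (?L \<union> ?R)"
    by auto
  have "1 = sum ?s (?OP \<union> (?L \<union> ?R))"
    using alternating_sum_disjoint_pairs[of K "{}" "{}"] assms unfolding split by simp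
  also have "\<dots> = sum ?s ?OP + sum ?s (?L \<union> ?R)"
    using fin assms by (intro sum.union_disjoint) auto
  also have "sum ?s (?L \<union> ?R) = sum ?s ?L + sum ?s ?R"
    using assms by (intro sum.union_disjoint) auto
  also have "sum ?s ?L = 0" using alt by (simp add: sum.cartesian_product[symmetric])
  also have "sum ?s ?R = (\<Sum>I\<in>Pow K - {{}}. (- 1) ^ (card K - card I))"
    by (simp add: sum.cartesian_product[symmetric])
  \<comment> \<open>The sum over all of \<open>Pow K\<close> is \<open>0\<close>, and the removed
    term at \<open>{}\<close> is \<open>(- 1) ^ card K = - 1\<close>; this is where oddness
    enters.\<close>
  also have "\<dots> = 1" using alt assms by (subst sum_diff1) auto
  finally show ?thesis by simp
qed

lemma card_edges_support_graph:
  assumes "finite K" "\<forall>i\<in>K. g i > 0" "n \<noteq> 0 \<or> odd (card K)"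
  shows "int (card (edges (support_graph g K n))) =
    int (card (factorizations g K n) choose 2) +
    (\<Sum>P\<in>disjoint_pairs K.
      (- 1) ^ (card K - (\<Sum>I\<in>P. card I) + 1) * (\<Prod>I\<in>P. int (card (factorizations g I n))))"
proof -
  let ?OP = "{(I, J). I \<subset> K \<and> J \<subset> K \<and> I \<noteq> {} \<and> J \<noteq> {} \<and> I \<inter> J = {}}"
  let ?F = "\<lambda>I. int (card (factorizations g I n))"
  let ?h = "\<lambda>P. (- 1) ^ (card K - (\<Sum>I\<in>P. card I) + 1) * (\<Prod>I\<in>P. ?F I)"
  let ?S = "\<Sum>(I, J)\<in>?OP. (- 1) ^ (card K - card I - card J) * (?F I * ?F J)"
  have fin: "finite ?OP"
    by (rule finite_subset[of _ "Pow K \<times> Pow K"]) (use assms in auto)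
  have "disjoint_pairs K = {{x, y} | x y. (x, y) \<in> ?OP}"
    by (auto simp: disjoint_pairs_def)
  moreover have "(\<Sum>(I, J)\<in>?OP. ?h {I, J}) = 2 * (\<Sum>P\<in>{{x, y} | x y. (x, y) \<in> ?OP}. ?h P)"
    by (rule sum_unordered_pairs[OF fin]) auto
  ultimately have "2 * (\<Sum>P\<in>disjoint_pairs K. ?h P) = (\<Sum>(I, J)\<in>?OP. ?h {I, J})"
    by (simp only:)
  \<comment> \<open>The extra \<open>+ 1\<close> in the exponent is the minus sign with which
    non-edges are subtracted. Disjoint nonempty \<open>I\<close> and \<open>J\<close> differ, so
    sums and products over \<open>{I, J}\<close> have two terms.\<close>
  also have "\<dots> = (\<Sum>(I, J)\<in>?OP. - ((- 1) ^ (card K - card I - card J) * (?F I * ?F J)))"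
  proof (intro sum.cong refl)
    fix p assume "p \<in> ?OP"
    then obtain I J where p: "p = (I, J)" "I \<noteq> {}" "I \<inter> J = {}" by auto
    then have "I \<noteq> J" by auto
    then show "(case p of (I, J) \<Rightarrow> ?h {I, J}) =
      (case p of (I, J) \<Rightarrow> - ((- 1) ^ (card K - card I - card J) * (?F I * ?F J)))"
      by (simp add: p diff_diff_left)
  qed
  also have "\<dots> = - ?S" by (simp add: case_prod_unfold sum_negf)
  finally have 2: "2 * (\<Sum>P\<in>disjoint_pairs K. ?h P) = - ?S" .
  show ?thesis
  proof (cases "n = 0")
    case False
    then have "2 * int (card (edges (support_graph g K n))) + ?S = 2 * int (card (factorizations g K n) choose 2)"
      using edges_plus_disjoint_supports[OF assms(1,2) False]
      unfolding sum_ordered_pairs_disjoint[OF assms(1,2) False] by linarith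
    with 2 show ?thesis by linarith
  next
    \<comment> \<open>Only the zero factorization exists: there is no edge and the binomial
      coefficient is \<open>0\<close>, so the signed sum has to vanish as well.\<close>
    case True
    have one: "?F I = 1" if "I \<subseteq> K" for I
    proof -
      have "finite I" "\<forall>i\<in>I. g i > 0" using that assms by (auto dest: finite_subset)
      then show ?thesis using factorizations_zero[of I g] True by simp
    qed
    have "?S = (\<Sum>(I, J)\<in>?OP. (- 1) ^ (card K - card I - card J))"
      by (intro sum.cong refl) (auto simp: one)
    then have "?S = 0" using alternating_sum_proper_pairs[OF assms(1)] assms True by simp
    moreover have "edges (support_graph g K n) = {}"
      using factorizations_zero[OF assms(1,2)] True by (auto simp: edges_def support_graph_def)
    moreover have "card (factorizations g K n) = 1"
      using factorizations_zero[OF assms(1,2)] True by simp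
    ultimately show ?thesis using 2 by simp
  qed
qed

subsection \<open>Quasipolynomials\<close>

lemma coeff_mult_le_degrees:
  fixes p q :: "real poly"
  assumes "degree p \<le> m" "degree q \<le> n"
  shows "coeff (p * q) (m + n) = coeff p m * coeff q n"
proof (cases "degree p = m \<and> degree q = n")
  case True
  then show ?thesis using coeff_mult_degree_sum[of p q] by auto
next
  case False
  then have "degree p + degree q < m + n" using assms by linarith
  then have "coeff (p * q) (m + n) = 0"
    by (intro coeff_eq_0) (use degree_mult_le[of p q] in linarith)
  moreover have "coeff p m = 0 \<or> coeff q n = 0"
    using False assms coeff_eq_0 le_neq_implies_less by blast
  ultimately show ?thesis by auto
qed

text \<open>A translation of the variable fixes the top coefficient. Here \<open>d\<close> is only
  an upper bound for the degree, because the top coefficient of a quasipolynomial may vanish on some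
  residue classes.\<close>

lemma coeff_pcompose_shift:
  fixes p :: "real poly"
  assumes "degree p \<le> d"
  shows "coeff (pcompose p [:b, 1:]) d = coeff p d"
proof (cases "degree p = d")
  case True
  then show ?thesis using lead_coeff_comp[of "[:b, 1:]" p] by (simp add: degree_pcompose)
next
  case False
  then have "degree p < d" using assms by simp
  then show ?thesis by (simp add: coeff_eq_0 degree_pcompose)
qed

text \<open>A monomial whose difference has the same top term as \<open>p\<close> is split off; the
  rest has smaller degree and is handled by induction.\<close>

lemma discrete_antiderivative:
  fixes p :: "real poly" and h :: real
  assumes "h \<noteq> 0" "degree p \<le> d"
  shows "\<exists>q. degree q \<le> Suc d \<and> coeff q (Suc d) = coeff p d / (h * real (Suc d)) \<and>
    (\<forall>x. poly q (x + h) - poly q x = poly p x)"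
  using assms(2)
proof (induction d arbitrary: p)
  case 0
  then obtain a where "p = [:a:]" by (auto dest: degree_eq_zeroE)
  then show ?case using assms(1)
    by (intro exI[of _ "[:0, a / h:]"]) (auto simp: field_simps)
next
  case (Suc d)
  let ?n = "Suc (Suc d)"
  \<comment> \<open>The leading term of \<open>(x + h) ^ ?n - x ^ ?n\<close> is
    \<open>?n * h * x ^ Suc d\<close>, so this \<open>c\<close> makes the difference of
    \<open>q\<close> match the top coefficient of \<open>p\<close>.\<close>
  define c where "c = coeff p (Suc d) / (h * real ?n)"
  define q where "q = monom c ?n"
  define r where "r = p - (pcompose q [:h, 1:] - q)"
  have degq: "degree q \<le> ?n" by (simp add: q_def degree_monom_le)
  have qe: "pcompose q [:h, 1:] = smult c ([:h, 1:] ^ ?n)"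
    unfolding poly_eq_poly_eq_iff[symmetric] by (simp add: fun_eq_iff poly_pcompose q_def poly_monom add.commute del: power_Suc)
  have top: "coeff (pcompose q [:h, 1:] - q) (Suc d) = coeff p (Suc d)"
    using assms(1) unfolding coeff_diff qe coeff_smult by (simp add: coeff_linear_poly_power q_def c_def del: power_Suc)
  have "degree r \<le> d"
  proof (rule degree_le, intro allI impI)
    fix i assume "d < i"
    then consider "i = Suc d" | "i = ?n" | "i > ?n" by linarith
    then show "coeff r i = 0"
    proof cases
      case 1
      then show ?thesis using top by (simp add: r_def)
    next
      case 2
      then show ?thesis
        using Suc.prems coeff_pcompose_shift[OF degq] by (simp add: r_def coeff_eq_0)
    next
      case 3
      then show ?thesis using Suc.prems degq
        by (simp add: r_def coeff_eq_0 degree_pcompose)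
    qed
  qed
  from Suc.IH[OF this] obtain s where s: "degree s \<le> Suc d"
    "\<And>x. poly s (x + h) - poly s x = poly r x" by blast
  show ?case
  proof (intro exI conjI allI)
    show "degree (q + s) \<le> ?n" using degq s by (intro degree_add_le) auto
    show "coeff (q + s) ?n = coeff p (Suc d) / (h * real ?n)"
      using s by (simp add: q_def c_def coeff_eq_0)
    fix x
    show "poly (q + s) (x + h) - poly (q + s) x = poly p x"
      using s(2)[of x] by (simp add: r_def poly_pcompose add.commute)
  qed
qed

text \<open>The congruence for \<open>q\<close> is solvable iff \<open>gcd c h\<close> divides
  \<open>r\<close>, and its solutions then form one residue class modulo
  \<open>c div gcd c h\<close>. This modulus divides \<open>L div h\<close>, so the range is covered
  by full periods and the count is exact. It determines how the leading coefficient changes when a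
  generator is added.\<close>

lemma card_multiples_in_progression:
  fixes c h r L :: nat
  assumes "c > 0" "h > 0" "c dvd L" "h dvd L"
  shows "real (card {q\<in>{..<L div h}. c dvd r + Suc q * h}) =
    (if gcd c h dvd r then real L * real (gcd c h) / (real h * real c) else 0)"
proof (cases "gcd c h dvd r")
  case False
  have "gcd c h dvd r" if "c dvd r + Suc q * h" for q
  proof -
    have "gcd c h dvd r + Suc q * h" using that by (meson dvd_trans gcd_dvd1)
    then show ?thesis by (metis dvd_add_left_iff dvd_mult gcd_dvd2)
  qed
  with False show ?thesis by (auto simp: card_eq_0_iff)
next
  case True
  define d where "d = gcd c h"
  have "d > 0" using assms by (simp add: d_def)
  define c' h' r' where "c' = c div d" and "h' = h div d" and "r' = r div d"
  have c: "c = d * c'" and h: "h = d * h'" and r: "r = d * r'"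
    using True by (simp_all add: c'_def h'_def r'_def d_def)
  have "coprime h' c'"
    unfolding h'_def c'_def d_def using assms
    by (metis coprime_commute div_gcd_coprime gcd_nat.neutr_eq_iff less_irrefl)
  have "c' > 0" using assms c by auto
  have eq: "c dvd r + Suc q * h \<longleftrightarrow> c' dvd r' + Suc q * h'" for q
  proof -
    have "r + Suc q * h = d * (r' + Suc q * h')" by (simp add: h r algebra_simps)
    then show ?thesis using \<open>d > 0\<close> by (simp add: c)
  qed
  have "\<exists>q. c' dvd r' + Suc q * h'"
  proof -
    obtain x where x: "[h' * x = Suc 0] (mod c')"
      using \<open>coprime h' c'\<close> cong_solve_coprime_nat by blast
    \<comment> \<open>A natural number standing for \<open>- (r' + h')\<close> modulo
      \<open>c'\<close>. As \<open>x\<close> inverts \<open>h'\<close>, the choice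
      \<open>q = x * m\<close> solves the congruence.\<close>
    define m where "m = (r' + h') * (c' - 1)"
    have "c' dvd r' + h' + m"
    proof -
      have "r' + h' + m = (r' + h') * c'"
        using \<open>c' > 0\<close> by (cases c') (auto simp: m_def algebra_simps)
      then show ?thesis by simp
    qed
    moreover have "[r' + h' + h' * x * m = r' + h' + 1 * m] (mod c')"
      using x by (intro cong_add cong_mult cong_refl) simp
    ultimately have "c' dvd r' + h' + h' * x * m"
      using cong_dvd_iff by fastforce
    then show ?thesis by (intro exI[of _ "x * m"]) (simp add: algebra_simps)
  qed
  then obtain q0 where q0: "c' dvd r' + Suc q0 * h'" by blast
  \<comment> \<open>Cancelling the unit \<open>h'\<close> shows that any two solutions agree modulo
    \<open>c'\<close>.\<close>
  have sol: "c' dvd r' + Suc q * h' \<longleftrightarrow> q mod c' = q0 mod c'" for q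
  proof -
    have "c' dvd r' + Suc q * h' \<longleftrightarrow> [r' + Suc q * h' = r' + Suc q0 * h'] (mod c')"
      using q0 by (metis cong_0_iff cong_dvd_iff cong_sym cong_trans)
    also have "\<dots> \<longleftrightarrow> [Suc q * h' = Suc q0 * h'] (mod c')"
      by (simp add: cong_add_lcancel_nat)
    also have "\<dots> \<longleftrightarrow> [Suc q = Suc q0] (mod c')"
      using \<open>coprime h' c'\<close> by (rule cong_mult_rcancel_nat)
    also have "\<dots> \<longleftrightarrow> [q = q0] (mod c')"
      using cong_add_rcancel_nat[of q 1 q0 c'] by simp
    finally show ?thesis by (simp add: cong_def)
  qed
  have "c' * h dvd L"
  proof -
    have "c' * h = lcm c h"
      using assms by (simp add: lcm_nat_def c'_def d_def div_mult_swap mult.commute)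
    then show ?thesis using assms by simp
  qed
  then obtain t where t: "L = c' * h * t" ..
  have Lh: "L div h = t * c'" using t assms by simp
  have "{q\<in>{..<L div h}. c dvd r + Suc q * h} = (\<lambda>s. s * c' + q0 mod c') ` {..<t}"
  proof (intro equalityI subsetI)
    fix q assume "q \<in> {q\<in>{..<L div h}. c dvd r + Suc q * h}"
    then have q: "q < t * c'" "q mod c' = q0 mod c'" by (simp_all only: mem_Collect_eq lessThan_iff Lh eq sol)
    then have "q = (q div c') * c' + q0 mod c'" by (metis div_mult_mod_eq)
    moreover have "q div c' < t" using q by (simp add: less_mult_imp_div_less)
    ultimately show "q \<in> (\<lambda>s. s * c' + q0 mod c') ` {..<t}" by blast
  next
    fix q assume "q \<in> (\<lambda>s. s * c' + q0 mod c') ` {..<t}"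
    then obtain s where s: "s < t" "q = s * c' + q0 mod c'" by auto
    have "q < Suc s * c'" using s \<open>c' > 0\<close> by (simp add: add.commute)
    also have "\<dots> \<le> t * c'" using s by (intro mult_le_mono1) simp
    finally show "q \<in> {q\<in>{..<L div h}. c dvd r + Suc q * h}"
      using s by (simp only: mem_Collect_eq lessThan_iff Lh eq sol) simp
  qed
  moreover have "inj (\<lambda>s. s * c' + q0 mod c')" using \<open>c' > 0\<close> by (auto simp: inj_on_def)
  ultimately have "card {q\<in>{..<L div h}. c dvd r + Suc q * h} = t"
    by (simp add: card_image inj_on_subset)
  moreover have "real L * real d / (real h * real c) = real t"
    using \<open>d > 0\<close> \<open>c' > 0\<close> \<open>h > 0\<close> unfolding t c by simp
  ultimately show ?thesis using True by (simp add: d_def)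
qed

section \<open>Periods and periodic families of polynomials\<close>

lemma minimal_period_dvd:
  fixes a :: "'i \<Rightarrow> nat \<Rightarrow> 'b"
  assumes "L > 0" "\<forall>i\<in>A. \<forall>n. a i (n + L) = a i n"
  shows "(LEAST p. p > 0 \<and> (\<forall>i\<in>A. \<forall>n. a i (n + p) = a i n)) dvd L"
proof -
  let ?P = "\<lambda>p. p > 0 \<and> (\<forall>i\<in>A. \<forall>n. a i (n + p) = a i n)"
  define p where "p = (LEAST p. ?P p)"
  have p: "?P p" unfolding p_def by (rule LeastI[of ?P L]) (use assms in auto)
  have mult: "a i (n + m * p) = a i n" if "i \<in> A" for i n m
  proof (induction m)
    case (Suc m)
    have "a i (n + Suc m * p) = a i ((n + m * p) + p)" by (simp add: algebra_simps)
    with Suc p that show ?case by simp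
  qed simp
  \<comment> \<open>The remainder of \<open>L\<close> modulo \<open>p\<close> leaves every
    \<open>a i\<close> invariant and is smaller than the least period \<open>p\<close>, hence it is
    \<open>0\<close>.\<close>
  have "a i (n + L mod p) = a i n" if "i \<in> A" for i n
  proof -
    have "a i (n + L mod p) = a i ((n + L mod p) + (L div p) * p)"
      by (simp only: mult[OF that])
    also have "\<dots> = a i (n + L)" by (simp only: add.assoc mod_div_mult_eq)
    finally show ?thesis using assms(2) that by metis
  qed
  then have "L mod p = 0"
    using not_less_Least[of "L mod p" ?P] p unfolding p_def[symmetric] by fastforce
  then show ?thesis unfolding p_def by auto
qed

lemma periodic_mod:
  fixes a :: "nat \<Rightarrow> 'b" and n L :: nat
  assumes "\<And>n. a (n + L) = a n"
  shows "a (n mod L) = a n"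
proof -
  have "a (m + q * L) = a m" for m q
  proof (induction q)
    case (Suc q)
    then show ?case using assms[of "m + q * L"] by (simp add: algebra_simps)
  qed simp
  from this[of "n mod L" "n div L"] show ?thesis by simp
qed

text \<open>A quasipolynomial is represented by a periodic family of polynomials, the one at
  \<open>n\<close> being evaluated at \<open>n\<close> itself. Subtracting an antiderivative with
  step \<open>L\<close> from \<open>f\<close> leaves an \<open>L\<close>-periodic function, which is
  absorbed into the constant terms and does not affect the coefficient at
  \<open>Suc d\<close>.\<close>

lemma quasipolynomial_antidifference:
  fixes f :: "nat \<Rightarrow> real" and P :: "nat \<Rightarrow> real poly"
  assumes "L > 0" "\<And>n. P (n + L) = P n" "\<And>n. degree (P n) \<le> d"
    and "\<And>n. f (n + L) - f n = poly (P n) (real n)"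
  obtains Q where "\<And>n. Q (n + L) = Q n" "\<And>n. degree (Q n) \<le> Suc d"
    "\<And>n. coeff (Q n) (Suc d) = coeff (P n) d / (real L * real (Suc d))"
    "\<And>n. f n = poly (Q n) (real n)"
proof -
  have "\<exists>q. degree q \<le> Suc d \<and> coeff q (Suc d) = coeff (P n) d / (real L * real (Suc d)) \<and>
    (\<forall>x. poly q (x + real L) - poly q x = poly (P n) x)" for n
    using assms(1,3) by (intro discrete_antiderivative) auto
  then obtain R where R: "\<And>n. degree (R n) \<le> Suc d"
    "\<And>n. coeff (R n) (Suc d) = coeff (P n) d / (real L * real (Suc d))"
    "\<And>n x. poly (R n) (x + real L) - poly (R n) x = poly (P n) x"
    by metis
  \<comment> \<open>The polynomials \<open>R n\<close> are chosen separately for each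
    \<open>n\<close> and need not be periodic in \<open>n\<close>; using the one at the residue
    makes them so.\<close>
  define r where "r n = n mod L" for n
  define e where "e n = f n - poly (R (r n)) (real n)" for n
  have Pr: "P (r n) = P n" for n unfolding r_def by (rule periodic_mod) (rule assms)
  have e: "e (n + L) = e n" for n
    using R(3)[of "r n" "real n"] assms(4)[of n] by (simp add: e_def r_def Pr[unfolded r_def])
  have er: "e (r n) = e n" for n unfolding r_def by (rule periodic_mod) (rule e)
  show ?thesis
  proof (rule that[of "\<lambda>n. R (r n) + [:e (r n):]"])
    fix n
    show "R (r (n + L)) + [:e (r (n + L)):] = R (r n) + [:e (r n):]" by (simp add: r_def)
    show "degree (R (r n) + [:e (r n):]) \<le> Suc d" using R(1) by (intro degree_add_le) auto
    show "coeff (R (r n) + [:e (r n):]) (Suc d) = coeff (P n) d / (real L * real (Suc d))"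
      by (simp add: R(2) Pr)
    show "f n = poly (R (r n) + [:e (r n):]) (real n)"
      by (simp add: er) (simp add: e_def)
  qed
qed

subsection \<open>The number of factorizations\<close>

definition nfact :: "(nat \<Rightarrow> nat) \<Rightarrow> nat set \<Rightarrow> nat \<Rightarrow> nat" where
  "nfact g I n = card (factorizations g I n)"

text \<open>Factorizations with \<open>z j > 0\<close> arise from those of \<open>n\<close> by one
  more copy of \<open>g j\<close>; those with \<open>z j = 0\<close> use \<open>I\<close>
  only.\<close>

lemma nfact_insert_add:
  assumes "finite I" "\<forall>i\<in>insert j I. g i > 0" "j \<notin> I"
  shows "nfact g (insert j I) (n + g j) = nfact g (insert j I) n + nfact g I (n + g j)"
proof -
  let ?up = "\<lambda>z. z(j := Suc (z j))"
  have fin: "finite (factorizations g (insert j I) m)" "finite (factorizations g I m)" for m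
    using assms by (auto intro: finite_factorizations)
  have sum_eq: "(\<Sum>i\<in>I. (z(j := x)) i * g i) = (\<Sum>i\<in>I. z i * g i)" for z :: "nat \<Rightarrow> nat" and x
    using assms by (intro sum.cong) auto
  have "factorizations g (insert j I) (n + g j) =
    ?up ` factorizations g (insert j I) n \<union> factorizations g I (n + g j)" (is "?A = ?B \<union> ?C")
  proof (intro equalityI subsetI)
    fix z assume z: "z \<in> ?A"
    show "z \<in> ?B \<union> ?C"
    proof (cases "z j")
      case 0
      have "z i = 0" if "i \<notin> I" for i
        using that z 0 by (cases "i = j") (auto simp: factorizations_def)
      then have "z \<in> ?C" using z 0 assms by (simp add: factorizations_def)
      then show ?thesis ..
    next
      case (Suc x)
      then have "z(j := x) \<in> factorizations g (insert j I) n"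
        using z assms sum_eq[of z x] by (auto simp: factorizations_def)
      moreover have "z = ?up (z(j := x))" using Suc by auto
      ultimately show ?thesis by blast
    qed
  next
    fix z assume "z \<in> ?B \<union> ?C"
    then show "z \<in> ?A"
    proof
      assume "z \<in> ?C"
      then show ?thesis using assms by (auto simp: factorizations_def)
    next
      assume "z \<in> ?B"
      then obtain w where w: "w \<in> factorizations g (insert j I) n" "z = ?up w" by blast
      then show ?thesis using assms sum_eq[of w "Suc (w j)"] by (auto simp: factorizations_def)
    qed
  qed
  moreover have "?B \<inter> ?C = {}"
    using assms by (auto simp: factorizations_def)
  moreover have "inj ?up"
  proof (rule injI)
    fix z w assume "?up z = ?up w"
    then show "z = w" by (metis fun_upd_triv fun_upd_upd fun_upd_same nat.inject)
  qed
  ultimately show ?thesis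
    using fin by (simp add: nfact_def card_Un_disjoint card_image inj_on_subset)
qed

lemma nfact_insert_add_mult:
  assumes "finite I" "\<forall>i\<in>insert j I. g i > 0" "j \<notin> I"
  shows "nfact g (insert j I) (n + t * g j) =
    nfact g (insert j I) n + (\<Sum>q<t. nfact g I (n + Suc q * g j))"
proof (induction t)
  case (Suc t)
  have "nfact g (insert j I) (n + Suc t * g j) = nfact g (insert j I) ((n + t * g j) + g j)"
    by (simp add: algebra_simps)
  also have "\<dots> = nfact g (insert j I) (n + t * g j) + nfact g I (n + t * g j + g j)"
    by (rule nfact_insert_add[OF assms])
  finally show ?case using Suc by (simp add: algebra_simps)
qed simp

lemma nfact_singleton:
  assumes "g j > 0"
  shows "nfact g {j} n = (if g j dvd n then 1 else 0)"
proof (cases "g j dvd n")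
  case True
  then obtain q where q: "n = g j * q" ..
  have "factorizations g {j} n = {(\<lambda>_. 0)(j := q)}"
    using assms q by (auto simp: factorizations_def fun_eq_iff)
  then show ?thesis using True by (simp add: nfact_def)
next
  case False
  then have "factorizations g {j} n = {}" by (auto simp: factorizations_def)
  then show ?thesis using False by (simp add: nfact_def)
qed

text \<open>Each added generator \<open>h\<close> sums \<open>L div h\<close> shifted copies of the
  old count and then takes an antiderivative. The leading coefficient is carried along exactly,
  including its vanishing when the gcd does not divide \<open>n\<close>.\<close>

lemma nfact_quasipolynomial:
  assumes "finite I" "I \<noteq> {}" "\<forall>i\<in>I. g i > 0 \<and> g i dvd L" "L > 0"
  shows "\<exists>P. (\<forall>n. P (n + L) = P n) \<and> (\<forall>n. degree (P n) \<le> card I - 1) \<and>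
    (\<forall>n. coeff (P n) (card I - 1) =
      (if Gcd (g ` I) dvd n then real (Gcd (g ` I)) / (fact (card I - 1) * (\<Prod>i\<in>I. real (g i))) else 0)) \<and>
    (\<forall>n. real (nfact g I n) = poly (P n) (real n))"
  using assms(1-3)
proof (induction I rule: finite_ne_induct)
  case (singleton j)
  have "g j dvd n + L \<longleftrightarrow> g j dvd n" for n using singleton by (simp add: dvd_add_left_iff)
  then show ?case using singleton
    by (intro exI[of _ "\<lambda>n. if g j dvd n then 1 else 0"]) (auto simp: nfact_singleton)
next
  case (insert j I)
  define c h N where "c = Gcd (g ` I)" and "h = g j" and "N = (\<Prod>i\<in>I. real (g i))"
  define d where "d = card I - 1"
  have card: "card I = Suc d" using insert by (simp add: d_def card_gt_0_iff)
  obtain P where P: "\<And>n. P (n + L) = P n" "\<And>n. degree (P n) \<le> d"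
    "\<And>n. coeff (P n) d = (if c dvd n then real c / (fact d * N) else 0)"
    "\<And>n. real (nfact g I n) = poly (P n) (real n)"
    using insert.IH insert.prems unfolding c_def N_def d_def by auto
  have h: "h > 0" "h dvd L" using insert by (auto simp: h_def)
  obtain i where "i \<in> I" using insert by blast
  then have "c dvd g i" "g i > 0" "g i dvd L" using insert by (auto simp: c_def)
  then have c: "c > 0" "c dvd L" by (auto intro: dvd_trans gcd_nat.neutr_eq_iff simp: dvd_pos_nat)
  have N: "N > 0" unfolding N_def using insert by (intro prod_pos) auto
  \<comment> \<open>The difference of the new count between \<open>n\<close> and
    \<open>n + L\<close>; composing with a translation turns values at \<open>n + Suc q * h\<close>
    into polynomials in \<open>n\<close>.\<close>
  define T where "T n = (\<Sum>q<L div h. pcompose (P (n + Suc q * h)) [:real (Suc q * h), 1:])" for n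
  have T1: "T (n + L) = T n" for n
  proof -
    have "P (n + L + Suc q * h) = P (n + Suc q * h)" for q
      using P(1)[of "n + Suc q * h"] by (simp add: algebra_simps)
    then show ?thesis by (simp add: T_def)
  qed
  have T2: "degree (T n) \<le> d" for n
    unfolding T_def using P(2) by (intro degree_sum_le) (auto simp: degree_pcompose)
  have T3: "real (nfact g (insert j I) (n + L)) - real (nfact g (insert j I) n) = poly (T n) (real n)" for n
  proof -
    have "n + L = n + (L div h) * g j" using h by (simp add: h_def)
    then show ?thesis
      using nfact_insert_add_mult[of I j g n "L div h"] insert
      by (simp add: T_def poly_sum poly_pcompose P(4) h_def add_ac)
  qed
  have T4: "coeff (T n) d = (if gcd c h dvd n then real L * real (gcd c h) / (real h * fact d * N) else 0)" for n
  proof -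
    have "coeff (T n) d = (\<Sum>q<L div h. coeff (P (n + Suc q * h)) d)"
      unfolding T_def by (simp add: coeff_sum coeff_pcompose_shift[OF P(2)])
    \<comment> \<open>Only shifts landing on a multiple of \<open>c\<close> contribute to the top
      coefficient, and all of them contribute equally.\<close>
    also have "\<dots> = (\<Sum>q\<in>{q\<in>{..<L div h}. c dvd n + Suc q * h}. real c / (fact d * N))"
      unfolding P(3) by (rule sum.inter_filter[symmetric]) simp
    also have "\<dots> = real (card {q\<in>{..<L div h}. c dvd n + Suc q * h}) * (real c / (fact d * N))"
      by simp
    also have "\<dots> = (if gcd c h dvd n then real L * real (gcd c h) / (real h * fact d * N) else 0)"
      unfolding card_multiples_in_progression[OF c(1) h(1) c(2) h(2)] using c by simp
    finally show ?thesis .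
  qed
  obtain Q where Q: "\<And>n. Q (n + L) = Q n" "\<And>n. degree (Q n) \<le> Suc d"
    "\<And>n. coeff (Q n) (Suc d) = coeff (T n) d / (real L * real (Suc d))"
    "\<And>n. real (nfact g (insert j I) n) = poly (Q n) (real n)"
    using quasipolynomial_antidifference[OF \<open>L > 0\<close> T1 T2 T3] by metis
  have G: "Gcd (g ` insert j I) = gcd c h" by (simp add: c_def h_def gcd.commute)
  have cd: "card (insert j I) - 1 = Suc d" using insert card by simp
  have Ni: "(\<Prod>i\<in>insert j I. real (g i)) = real h * N" using insert by (simp add: h_def N_def)
  have "coeff (Q n) (Suc d) =
    (if gcd c h dvd n then real (gcd c h) / (fact (Suc d) * (real h * N)) else 0)" for n
    unfolding Q(3) T4 fact_Suc using \<open>L > 0\<close> h(1) N by (simp add: divide_simps del: of_nat_Suc)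
  then show ?case unfolding G cd Ni
    using Q(1,2,4) by (intro exI[of _ Q]) auto
qed

subsection \<open>The edge count as a quasipolynomial\<close>

lemma of_nat_choose_two: "real (m choose 2) = (real m * real m - real m) / 2"
  by (induction m) (auto simp: numeral_2_eq_2 field_simps)

text \<open>For disjoint \<open>I\<close> and \<open>J\<close> the product of the counts has degree
  at most \<open>card I + card J - 2\<close>, hence at most \<open>card K - 2\<close>. With at least
  two generators this and the degree \<open>card K - 1\<close> of the linear term lie below
  \<open>2 * card K - 2\<close>, so the leading coefficient is half the square of that of the count
  over \<open>K\<close>.\<close>

lemma edge_count_quasipolynomial:
  fixes g :: "nat \<Rightarrow> nat"
  assumes "finite K" "\<forall>i\<in>K. g i > 0 \<and> g i dvd L" "L > 0" "card K \<ge> 2"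
  shows "\<exists>F. (\<forall>n. F (n + L) = F n) \<and> (\<forall>n. degree (F n) \<le> 2 * card K - 2) \<and>
    (\<forall>n. Gcd (g ` K) dvd n \<longrightarrow> coeff (F n) (2 * card K - 2) =
      (real (Gcd (g ` K)))\<^sup>2 / (2 * (fact (card K - 1))\<^sup>2 * (\<Prod>i\<in>K. (real (g i))\<^sup>2))) \<and>
    (\<forall>n. n \<noteq> 0 \<or> odd (card K) \<longrightarrow> real (card (edges (support_graph g K n))) = poly (F n) (real n))"
proof -
  let ?k = "card K"
  \<comment> \<open>Bundling the properties allows one choice of a family \<open>Q\<close> for all
    nonempty \<open>I\<close> in \<open>K\<close>.\<close>
  define good where "good I P \<longleftrightarrow> (\<forall>n. P (n + L) = P n) \<and> (\<forall>n. degree (P n) \<le> card I - 1) \<and>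
    (\<forall>n. coeff (P n) (card I - 1) =
      (if Gcd (g ` I) dvd n then real (Gcd (g ` I)) / (fact (card I - 1) * (\<Prod>i\<in>I. real (g i))) else 0)) \<and>
    (\<forall>n. real (nfact g I n) = poly (P n) (real n))" for I P
  have "\<exists>P. good I P" if "I \<subseteq> K" "I \<noteq> {}" for I
    unfolding good_def using assms that by (intro nfact_quasipolynomial) (auto dest: finite_subset)
  then obtain Q where "\<And>I. I \<subseteq> K \<Longrightarrow> I \<noteq> {} \<Longrightarrow> good I (Q I)"
    by metis
  then have Q: "\<And>I n. I \<subseteq> K \<Longrightarrow> I \<noteq> {} \<Longrightarrow> Q I (n + L) = Q I n"
    "\<And>I n. I \<subseteq> K \<Longrightarrow> I \<noteq> {} \<Longrightarrow> degree (Q I n) \<le> card I - 1"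
    "\<And>I n. I \<subseteq> K \<Longrightarrow> I \<noteq> {} \<Longrightarrow> coeff (Q I n) (card I - 1) =
      (if Gcd (g ` I) dvd n then real (Gcd (g ` I)) / (fact (card I - 1) * (\<Prod>i\<in>I. real (g i))) else 0)"
    "\<And>I n. I \<subseteq> K \<Longrightarrow> I \<noteq> {} \<Longrightarrow> real (nfact g I n) = poly (Q I n) (real n)"
    unfolding good_def by blast+
  have "K \<noteq> {}" using assms by auto
  have sub: "I \<subseteq> K \<and> I \<noteq> {}" if "I \<in> P" "P \<in> disjoint_pairs K" for I P
    using that by (auto simp: disjoint_pairs_def)
  have findp: "finite (disjoint_pairs K)"
    by (rule finite_subset[of _ "Pow (Pow K)"]) (use assms(1) in \<open>auto simp: disjoint_pairs_def\<close>)
  define T where "T P n = smult ((- 1) ^ (?k - (\<Sum>I\<in>P. card I) + 1)) (\<Prod>I\<in>P. Q I n)" for P n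
  define F where "F n = smult (1 / 2) (Q K n * Q K n - Q K n) + (\<Sum>P\<in>disjoint_pairs K. T P n)" for n
  have degT: "degree (T P n) < 2 * ?k - 2" if P: "P \<in> disjoint_pairs K" for P n
  proof -
    obtain I J where IJ: "P = {I, J}" "I \<subset> K" "J \<subset> K" "I \<noteq> {}" "J \<noteq> {}" "I \<inter> J = {}"
      using P by (auto simp: disjoint_pairs_def)
    then have fin: "finite I" "finite J" using assms(1) by (auto dest: finite_subset)
    have "card I + card J = card (I \<union> J)" using fin IJ by (simp add: card_Un_disjoint)
    also have "\<dots> \<le> ?k" using IJ assms by (intro card_mono) auto
    finally have "card I + card J \<le> ?k" .
    moreover have "card I > 0" "card J > 0" using fin IJ by (auto simp: card_gt_0_iff)
    moreover have "degree (T P n) \<le> (card I - 1) + (card J - 1)"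
    proof -
      have "I \<noteq> J" using IJ by auto
      then have "degree (T P n) \<le> degree (Q I n * Q J n)"
        using IJ by (simp add: T_def)
      also have "\<dots> \<le> degree (Q I n) + degree (Q J n)" by (rule degree_mult_le)
      also have "\<dots> \<le> (card I - 1) + (card J - 1)"
        using IJ by (intro add_mono Q(2)) auto
      finally show ?thesis .
    qed
    ultimately show ?thesis using assms(4) by linarith
  qed
  have kk: "2 * ?k - 2 = (?k - 1) + (?k - 1)" by simp
  have degK: "degree (Q K n) \<le> ?k - 1" for n using Q(2)[of K] \<open>K \<noteq> {}\<close> by simp
  have degKK: "degree (Q K n * Q K n) \<le> 2 * ?k - 2" for n
    using degree_mult_le[of "Q K n" "Q K n"] degK[of n] by linarith
  show ?thesis
  proof (intro exI[of _ F] conjI allI impI)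
    fix n
    show "F (n + L) = F n"
      unfolding F_def T_def using Q(1) \<open>K \<noteq> {}\<close> sub
      by (intro arg_cong2[where f = "(+)"] sum.cong prod.cong arg_cong2[where f = smult]
          arg_cong2[where f = "(-)"] arg_cong2[where f = "(*)"]) auto
    show "degree (F n) \<le> 2 * ?k - 2"
      unfolding F_def using degT degKK[of n] degK[of n] assms(4)
      by (intro degree_add_le degree_sum_le findp order_trans[OF degree_smult_le] degree_diff_le)
        (auto intro: less_imp_le)
    {
      assume "Gcd (g ` K) dvd n"
      have "coeff (\<Sum>P\<in>disjoint_pairs K. T P n) (2 * ?k - 2) = 0"
        using degT by (simp add: coeff_sum coeff_eq_0)
      moreover have "coeff (Q K n) (2 * ?k - 2) = 0"
        using degK[of n] assms(4) by (intro coeff_eq_0) linarith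
      moreover have "coeff (Q K n * Q K n) (2 * ?k - 2) = (coeff (Q K n) (?k - 1))\<^sup>2"
        unfolding kk power2_eq_square by (rule coeff_mult_le_degrees[OF degK degK])
      ultimately have "coeff (F n) (2 * ?k - 2) = (coeff (Q K n) (?k - 1))\<^sup>2 / 2"
        by (simp add: F_def)
      also have "\<dots> = (real (Gcd (g ` K)) / (fact (?k - 1) * (\<Prod>i\<in>K. real (g i))))\<^sup>2 / 2"
        using Q(3)[of K n] \<open>K \<noteq> {}\<close> \<open>Gcd (g ` K) dvd n\<close> by simp
      also have "\<dots> = (real (Gcd (g ` K)))\<^sup>2 / (2 * (fact (?k - 1))\<^sup>2 * (\<Prod>i\<in>K. (real (g i))\<^sup>2))"
        by (simp add: power_divide power_mult_distrib prod_power_distrib)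
      finally show "coeff (F n) (2 * ?k - 2) =
        (real (Gcd (g ` K)))\<^sup>2 / (2 * (fact (?k - 1))\<^sup>2 * (\<Prod>i\<in>K. (real (g i))\<^sup>2))" .
    }
    {
      assume n: "n \<noteq> 0 \<or> odd ?k"
      have "real (card (edges (support_graph g K n))) = real_of_int (int (card (edges (support_graph g K n))))"
        by simp
      also have "\<dots> = real (nfact g K n choose 2) +
        (\<Sum>P\<in>disjoint_pairs K. (- 1) ^ (?k - (\<Sum>I\<in>P. card I) + 1) * (\<Prod>I\<in>P. real (nfact g I n)))"
        using assms(2) by (subst card_edges_support_graph[OF assms(1) _ n]) (auto simp: nfact_def)
      also have "\<dots> = poly (smult (1 / 2) (Q K n * Q K n - Q K n)) (real n) + (\<Sum>P\<in>disjoint_pairs K. poly (T P n) (real n))"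
        using \<open>K \<noteq> {}\<close> sub
        by (intro arg_cong2[where f = "(+)"] sum.cong) (auto simp: of_nat_choose_two Q(4) T_def poly_prod intro!: prod.cong)
      also have "\<dots> = poly (F n) (real n)" by (simp add: F_def poly_sum)
      finally show "real (card (edges (support_graph g K n))) = poly (F n) (real n)" .
    }
  qed
qed

text \<open>The quasipolynomial \<open>f\<close> is separate from the edge count because for even
  \<open>k \<ge> 2\<close> the formula gives \<open>- 1\<close> at \<open>n = 0\<close>, where the
  graph has no edge. A single positive generator gives at most one factorization, so there is no
  edge and no nonzero leading coefficient; hence \<open>k \<ge> 2\<close> in the second
  part.\<close>

theorem theorem3p6:
  fixes k :: nat and g :: "nat \<Rightarrow> nat"
  assumes pos: "\<forall>i\<in>{1..k}. g i > 0"
    and minimal: "minimal_generators g {1..k}"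
  shows
    "(\<forall>n\<in>gen_semigroup g {1..k}. n \<noteq> 0 \<or> odd k \<longrightarrow>
        int (card (edges (support_graph g {1..k} n))) =
          int (card (factorizations g {1..k} n) choose 2) +
          (\<Sum>P\<in>disjoint_pairs {1..k}.
             (- 1) ^ (k - (\<Sum>I\<in>P. card I) + 1) * (\<Prod>I\<in>P. int (card (factorizations g I n)))))
     \<and>
     (k \<ge> 2 \<longrightarrow>
        (\<exists>f a. quasipolynomial_with_coeffs f (2 * k - 2) a \<and>
           (\<forall>n. n \<noteq> 0 \<or> odd k \<longrightarrow> real (card (edges (support_graph g {1..k} n))) = f n) \<and>
           (\<forall>n. Gcd (g ` {1..k}) dvd n \<longrightarrow>
              a (2 * k - 2) n =
                (real (Gcd (g ` {1..k})))\<^sup>2 /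
                (2 * (fact (k - 1))\<^sup>2 * (\<Prod>i=1..k. (real (g i))\<^sup>2))) \<and>
           quasi_period (2 * k - 2) a dvd Lcm (g ` {1..k})))"
proof (intro conjI ballI impI)
  fix n :: nat assume "n \<noteq> 0 \<or> odd k"
  then show "int (card (edges (support_graph g {1..k} n))) =
      int (card (factorizations g {1..k} n) choose 2) +
      (\<Sum>P\<in>disjoint_pairs {1..k}.
        (- 1) ^ (k - (\<Sum>I\<in>P. card I) + 1) * (\<Prod>I\<in>P. int (card (factorizations g I n))))"
    using card_edges_support_graph[of "{1..k}" g n] pos by simp
next
  assume "k \<ge> 2"
  let ?K = "{1..k}" and ?d = "2 * k - 2"
  define L where "L = Lcm (g ` ?K)"
  have "0 \<notin> g ` ?K" using pos by force
  then have "L \<noteq> 0" by (simp add: L_def Lcm_0_iff)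
  then have "L > 0" by simp
  then have L: "L > 0" "\<forall>i\<in>?K. g i > 0 \<and> g i dvd L"
    using pos by (simp_all add: L_def)
  have cardK: "card ?K = k" by simp
  obtain F where F: "\<And>n. F (n + L) = F n" "\<And>n. degree (F n) \<le> ?d"
    "\<And>n. Gcd (g ` ?K) dvd n \<Longrightarrow> coeff (F n) ?d =
      (real (Gcd (g ` ?K)))\<^sup>2 / (2 * (fact (k - 1))\<^sup>2 * (\<Prod>i=1..k. (real (g i))\<^sup>2))"
    "\<And>n :: nat. n \<noteq> 0 \<or> odd k \<Longrightarrow> real (card (edges (support_graph g ?K n))) = poly (F n) (real n)"
    using edge_count_quasipolynomial[of ?K g L, unfolded cardK, OF finite_atLeastAtMost L(2,1) \<open>k \<ge> 2\<close>]
    by blast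
  define a where "a i n = coeff (F n) i" for i n
  have per: "a i (n + L) = a i n" for i n by (simp add: a_def F(1))
  have "Gcd (g ` ?K) \<noteq> 0"
  proof
    assume "Gcd (g ` ?K) = 0"
    moreover have "1 \<in> ?K" using \<open>k \<ge> 2\<close> by simp
    ultimately have "g 1 = 0" by (auto simp only: Gcd_0_iff)
    with pos \<open>1 \<in> ?K\<close> show False by fastforce
  qed
  \<comment> \<open>The argument \<open>0\<close> is divisible by the gcd, so the formula for the
    leading coefficient applies there and shows that \<open>a ?d\<close> is not identically
    \<open>0\<close>.\<close>
  then have "a ?d 0 \<noteq> 0" using pos by (simp add: a_def F(3))
  moreover have "poly (F n) (real n) = (\<Sum>i\<le>?d. a i n * real n ^ i)" for n
    unfolding a_def poly_altdef using F(2)[of n]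
    by (intro sum.mono_neutral_left) (auto simp: coeff_eq_0)
  ultimately have "quasipolynomial_with_coeffs (\<lambda>n. poly (F n) (real n)) ?d a"
    using per L(1) unfolding quasipolynomial_with_coeffs_def periodic_def by blast
  moreover have "quasi_period ?d a dvd L"
    using minimal_period_dvd[of L "{..?d}" a] per L(1) by (simp add: quasi_period_def Ball_def)
  ultimately show "\<exists>f a. quasipolynomial_with_coeffs f ?d a \<and>
    (\<forall>n. n \<noteq> 0 \<or> odd k \<longrightarrow> real (card (edges (support_graph g ?K n))) = f n) \<and>
    (\<forall>n. Gcd (g ` ?K) dvd n \<longrightarrow> a ?d n =
      (real (Gcd (g ` ?K)))\<^sup>2 / (2 * (fact (k - 1))\<^sup>2 * (\<Prod>i=1..k. (real (g i))\<^sup>2))) \<and>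
    quasi_period ?d a dvd Lcm (g ` ?K)"
    using F(3,4) unfolding L_def[symmetric]
    by (intro exI[of _ "\<lambda>n. poly (F n) (real n)"] exI[of _ a]) (auto simp: a_def)
qed

end
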